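(* Let $\lambda\neq0$ be a complex number, $d\in\mathbb{N}$, and $u\in\mathbb{C}$ with $u\neq0$, $u\neq1$ and $u^d\neq1$. For every integer $n\ge0$, \[ h_{n,\lambda}(x|u)=d^n\left(\frac{-1+u^{-1}}{1-u^d}\right)\sum_{a=0}^{d-1}u^{d-a}\,h_{n,\lambda/d}\!\left(\left.\frac{a+x}{d}\right|u^d\right). \]
   Context: For a complex number $\mu\neq0$ and a variable $x$, the degenerate falling factorial is $(x|\mu)_0=1$ and $(x|\mu)_n=x(x-\mu)\cdots(x-(n-1)\mu)$ for $n\ge1$. The symbol $(1+\mu t)^{x/\mu}$ denotes the formal power series $\sum_{n\ge0}(x|\mu)_n\frac{t^n}{n!}$. For $v\in\mathbb{C}$, $v\neq1$, the degenerate Frobenius–Euler polynomials $h_{n,\mu}(x|v)$ are defined by \[ \frac{1-v}{(1+\mu t)^{1/\mu}-v}(1+\mu t)^{x/\mu}=\sum_{n=0}^\infty h_{n,\mu}(x|v)\frac{t^n}{n!}. \] *)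

theory Defs
  imports Complex_Main "HOL-Computational_Algebra.Computational_Algebra"
begin

text \<open>
  The variable \<open>x\<close> is the polynomial indeterminate \<open>[:0, 1:]\<close>, so all generating
  functions are formal power series in \<open>t\<close> over the ring of complex polynomials in \<open>x\<close>.
\<close>

definition degen_falling_fact :: "complex \<Rightarrow> complex poly \<Rightarrow> nat \<Rightarrow> complex poly" where
  "degen_falling_fact \<mu> p n = (\<Prod>k<n. p - [:of_nat k * \<mu>:])"

text \<open>The series \<open>(1 + \<mu> t)\<close> to the power \<open>p / \<mu>\<close>.\<close>

definition degen_power :: "complex \<Rightarrow> complex poly \<Rightarrow> complex poly fps" where
  "degen_power \<mu> p = Abs_fps (\<lambda>n. smult (1 / fact n) (degen_falling_fact \<mu> p n))"

text \<open>
  For \<open>v \<noteq> 1\<close> the denominator of the generating function has the invertible constant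
  coefficient \<open>1 - v\<close>. The class-based division of power series is not available here, since its
  coefficient ring would have to have an inverse operation; \<open>fps_right_inverse f y\<close> is the
  inverse of \<open>f\<close> whose constant coefficient is \<open>y\<close>.
\<close>

definition degen_frobenius_euler_gf :: "complex \<Rightarrow> complex \<Rightarrow> complex poly fps" where
  "degen_frobenius_euler_gf \<mu> v =
     fps_const [:1 - v:] *
     fps_right_inverse (degen_power \<mu> 1 - fps_const [:v:]) [:1 / (1 - v):] *
     degen_power \<mu> [:0, 1:]"

definition degen_frobenius_euler :: "nat \<Rightarrow> complex \<Rightarrow> complex \<Rightarrow> complex poly" where
  "degen_frobenius_euler n \<mu> v = smult (fact n) (fps_nth (degen_frobenius_euler_gf \<mu> v) n)"

lemma degen_frobenius_euler_gf_eq: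
  "Abs_fps (\<lambda>n. smult (1 / fact n) (degen_frobenius_euler n \<mu> v)) =
     degen_frobenius_euler_gf \<mu> v"
  by (rule fps_ext) (simp add: degen_frobenius_euler_def)

lemma degen_frobenius_euler_gf_unique:
  assumes "v \<noteq> 1"
  shows "(degen_power \<mu> 1 - fps_const [:v:]) * F = fps_const [:1 - v:] * degen_power \<mu> [:0, 1:]
     \<longleftrightarrow> F = degen_frobenius_euler_gf \<mu> v"
proof -
  let ?D = "degen_power \<mu> 1 - fps_const [:v:]"
  have D0: "fps_nth ?D 0 = [:1 - v:]"
    by (simp add: degen_power_def degen_falling_fact_def one_pCons)
  have "fps_nth ?D 0 * [:1 / (1 - v):] = 1"
    using assms unfolding D0 by (simp add: one_pCons)
  then have inv: "?D * fps_right_inverse ?D [:1 / (1 - v):] = 1"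
    by (rule fps_right_inverse)
  have nz: "?D \<noteq> 0"
    using D0 assms by auto
  have "?D * degen_frobenius_euler_gf \<mu> v =
      fps_const [:1 - v:] * (?D * fps_right_inverse ?D [:1 / (1 - v):]) * degen_power \<mu> [:0, 1:]"
    by (simp only: degen_frobenius_euler_gf_def mult_ac)
  then have *: "?D * degen_frobenius_euler_gf \<mu> v = fps_const [:1 - v:] * degen_power \<mu> [:0, 1:]"
    by (simp add: inv)
  show ?thesis
    using * nz by (metis mult_left_cancel)
qed

end

theory Submission
  imports Defs
begin

text \<open>
  Write \<open>E = (1 + l t)^(1/l)\<close>. Replacing \<open>t\<close> by \<open>d t\<close> turns \<open>(1 + (l/d) t)^(p/(l/d))\<close> into
  \<open>(1 + l t)^(d p/l)\<close>, so the generating function of the \<open>a\<close>-th summand becomes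
  \<open>(1 - u^d) E^(a + x) / (E^d - u^d)\<close>. Summing against \<open>u^(d - a)\<close> and using
  \<open>(E - u) (\<Sum>a<d. u^(d - 1 - a) E^a) = E^d - u^d\<close> leaves a multiple of \<open>E^x / (E - u)\<close>.
\<close>

lemma degen_power_nth:
  "fps_nth (degen_power \<mu> p) n = smult (1 / fact n) (\<Prod>k<n. p - [:of_nat k * \<mu>:])"
  by (simp add: degen_power_def degen_falling_fact_def)

lemma degen_power_nth_0 [simp]: "fps_nth (degen_power \<mu> p) 0 = 1"
  by (simp add: degen_power_nth)

lemma degen_power_recurrence:
  "of_nat (Suc n) * fps_nth (degen_power \<mu> p) (Suc n) =
     (p - [:of_nat n * \<mu>:]) * fps_nth (degen_power \<mu> p) n"
proof -
  have "of_nat (Suc n) * q = smult (of_nat (Suc n)) q" for q :: "complex poly"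
    by (simp add: of_nat_poly del: of_nat_Suc)
  then have "of_nat (Suc n) * fps_nth (degen_power \<mu> p) (Suc n) =
      smult (1 / fact n) ((\<Prod>k<n. p - [:of_nat k * \<mu>:]) * (p - [:of_nat n * \<mu>:]))"
    by (simp add: degen_power_nth del: of_nat_Suc)
  then show ?thesis
    by (simp only: degen_power_nth mult_smult_right mult.commute)
qed

lemma degen_power_ode:
  "(1 + fps_const [:\<mu>:] * fps_X) * fps_deriv (degen_power \<mu> p) = fps_const p * degen_power \<mu> p"
proof (rule fps_ext)
  fix n
  show "fps_nth ((1 + fps_const [:\<mu>:] * fps_X) * fps_deriv (degen_power \<mu> p)) n =
      fps_nth (fps_const p * degen_power \<mu> p) n"
  proof (cases n)
    case 0
    then show ?thesis
      using degen_power_recurrence[of 0 \<mu> p] by (simp add: distrib_right mult.assoc)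
  next
    case (Suc m)
    have "[:of_nat n * \<mu>:] = of_nat n * [:\<mu>:]"
      by (simp add: of_nat_poly)
    then show ?thesis
      using degen_power_recurrence[of n \<mu> p] Suc
      by (simp add: distrib_right mult.assoc algebra_simps)
  qed
qed

lemma degen_power_unique:
  assumes "(1 + fps_const [:\<mu>:] * fps_X) * fps_deriv F = fps_const p * F" and "fps_nth F 0 = 1"
  shows "F = degen_power \<mu> p"
proof (rule fps_ext)
  fix n
  show "fps_nth F n = fps_nth (degen_power \<mu> p) n"
  proof (induction n)
    case 0
    then show ?case by (simp add: assms(2))
  next
    case (Suc n)
    have c: "[:of_nat n * \<mu>:] = of_nat n * [:\<mu>:]"
      by (simp add: of_nat_poly)
    have "fps_nth ((1 + fps_const [:\<mu>:] * fps_X) * fps_deriv F) n = fps_nth (fps_const p * F) n"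
      using assms(1) by simp
    then have "of_nat (Suc n) * fps_nth F (Suc n) = (p - [:of_nat n * \<mu>:]) * fps_nth F n"
      unfolding c by (cases n) (simp_all add: distrib_right mult.assoc algebra_simps)
    also have "\<dots> = of_nat (Suc n) * fps_nth (degen_power \<mu> p) (Suc n)"
      by (simp only: Suc degen_power_recurrence)
    finally show ?case
      by (metis mult_left_cancel of_nat_eq_0_iff nat.distinct(1))
  qed
qed

lemma degen_power_add: "degen_power \<mu> (p + q) = degen_power \<mu> p * degen_power \<mu> q"
proof (rule degen_power_unique[symmetric])
  let ?c = "1 + fps_const [:\<mu>:] * fps_X" and ?P = "degen_power \<mu> p" and ?Q = "degen_power \<mu> q"
  have "?c * fps_deriv (?P * ?Q) = ?P * (?c * fps_deriv ?Q) + (?c * fps_deriv ?P) * ?Q"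
    by (simp only: fps_deriv_mult distrib_left mult_ac)
  also have "\<dots> = ?P * (fps_const q * ?Q) + (fps_const p * ?P) * ?Q"
    by (simp only: degen_power_ode)
  also have "\<dots> = (fps_const p + fps_const q) * (?P * ?Q)"
    by (simp only: distrib_left distrib_right mult_ac add_ac)
  finally show "?c * fps_deriv (?P * ?Q) = fps_const (p + q) * (?P * ?Q)"
    by simp
qed simp

lemma degen_power_0: "degen_power \<mu> 0 = 1"
  by (rule degen_power_unique[symmetric]) simp_all

lemma degen_power_of_nat: "degen_power \<mu> (of_nat m) = degen_power \<mu> 1 ^ m"
  by (induction m) (simp_all add: degen_power_0 degen_power_add)

definition fps_subst :: "complex \<Rightarrow> complex poly \<Rightarrow> complex poly fps \<Rightarrow> complex poly fps" where
  "fps_subst c q F = Abs_fps (\<lambda>n. smult (c ^ n) (pcompose (fps_nth F n) q))"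

lemma fps_subst_nth [simp]:
  "fps_nth (fps_subst c q F) n = smult (c ^ n) (pcompose (fps_nth F n) q)"
  by (simp add: fps_subst_def)

lemma smult_sum_right: "smult c (\<Sum>i\<in>A. f i) = (\<Sum>i\<in>A. smult c (f i))"
  by (induction A rule: infinite_finite_induct) (simp_all add: smult_add_right)

lemma fps_subst_mult: "fps_subst c q (F * G) = fps_subst c q F * fps_subst c q G"
proof (rule fps_ext)
  fix n
  have "smult (c ^ n) (pcompose (fps_nth F i * fps_nth G (n - i)) q) =
      smult (c ^ i) (pcompose (fps_nth F i) q) * smult (c ^ (n - i)) (pcompose (fps_nth G (n - i)) q)"
    if "i \<in> {0..n}" for i
    using that by (simp add: pcompose_mult mult.commute flip: power_add)
  then show "fps_nth (fps_subst c q (F * G)) n = fps_nth (fps_subst c q F * fps_subst c q G) n"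
    by (simp add: fps_mult_nth pcompose_sum smult_sum_right)
qed

lemma fps_subst_diff: "fps_subst c q (F - G) = fps_subst c q F - fps_subst c q G"
  by (rule fps_ext) (simp add: pcompose_diff smult_diff_right)

lemma fps_subst_const: "fps_subst c q (fps_const [:a:]) = fps_const [:a:]"
  by (rule fps_ext) (simp add: pcompose_pCons)

lemma fps_subst_degen_power:
  "fps_subst c q (degen_power \<mu> p) = degen_power (c * \<mu>) (smult c (pcompose p q))"
proof (rule fps_ext)
  fix n
  have "smult (c ^ n) (pcompose (\<Prod>k<n. p - [:of_nat k * \<mu>:]) q) =
      (\<Prod>k<n. smult c (pcompose p q) - [:of_nat k * (c * \<mu>):])"
  proof (induction n)
    case 0
    then show ?case by (simp add: pcompose_1)
  next
    case (Suc n)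
    let ?A = "pcompose (\<Prod>k<n. p - [:of_nat k * \<mu>:]) q"
    have last: "smult c (pcompose (p - [:of_nat n * \<mu>:]) q) =
        smult c (pcompose p q) - [:of_nat n * (c * \<mu>):]"
      by (simp add: pcompose_diff pcompose_pCons smult_diff_right mult_ac)
    have "smult (c ^ Suc n) (pcompose (\<Prod>k<Suc n. p - [:of_nat k * \<mu>:]) q) =
        smult (c ^ n) ?A * smult c (pcompose (p - [:of_nat n * \<mu>:]) q)"
      by (simp only: prod.lessThan_Suc pcompose_mult mult_smult_left mult_smult_right
          smult_smult power_Suc)
    then show ?case
      by (simp only: Suc last prod.lessThan_Suc)
  qed
  then have "smult (1 / fact n) (smult (c ^ n) (pcompose (\<Prod>k<n. p - [:of_nat k * \<mu>:]) q)) =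
      fps_nth (degen_power (c * \<mu>) (smult c (pcompose p q))) n"
    by (simp only: degen_power_nth)
  then show "fps_nth (fps_subst c q (degen_power \<mu> p)) n =
      fps_nth (degen_power (c * \<mu>) (smult c (pcompose p q))) n"
    by (simp only: fps_subst_nth degen_power_nth[of \<mu>] pcompose_smult smult_smult mult.commute)
qed

lemma frobenius_euler_gf_subst:
  fixes d a :: nat
  assumes "d \<ge> 1" and "v \<noteq> 1"
  shows "(degen_power l 1 ^ d - fps_const [:v:]) *
      fps_subst (of_nat d) [:of_nat a / of_nat d, 1 / of_nat d:]
        (degen_frobenius_euler_gf (l / of_nat d) v) =
    fps_const [:1 - v:] * (degen_power l 1 ^ a * degen_power l [:0, 1:])"
proof -
  let ?\<mu> = "l / of_nat d"
  let ?s = "fps_subst (of_nat d) [:of_nat a / of_nat d, 1 / of_nat d:]"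
  have d: "of_nat d \<noteq> (0 :: complex)"
    using assms(1) by simp
  have "?s (degen_power ?\<mu> 1) = degen_power l (of_nat d)"
    using d by (simp add: fps_subst_degen_power pcompose_1 of_nat_poly)
  then have s1: "?s (degen_power ?\<mu> 1) = degen_power l 1 ^ d"
    by (simp add: degen_power_of_nat)
  have "?s (degen_power ?\<mu> [:0, 1:]) = degen_power l (of_nat a + [:0, 1:])"
    using d by (simp add: fps_subst_degen_power pcompose_pCons of_nat_poly)
  then have sX: "?s (degen_power ?\<mu> [:0, 1:]) = degen_power l 1 ^ a * degen_power l [:0, 1:]"
    by (simp add: degen_power_add degen_power_of_nat)
  have "?s ((degen_power ?\<mu> 1 - fps_const [:v:]) * degen_frobenius_euler_gf ?\<mu> v) =
      ?s (fps_const [:1 - v:] * degen_power ?\<mu> [:0, 1:])"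
    using degen_frobenius_euler_gf_unique[OF assms(2)] by metis
  then show ?thesis
    by (simp only: fps_subst_mult fps_subst_diff fps_subst_const s1 sX)
qed

theorem theorem3:
  fixes l u :: complex and d n :: nat
  assumes "l \<noteq> 0" and "d \<ge> 1" and "u \<noteq> 0" and "u \<noteq> 1" and "u ^ d \<noteq> 1"
  shows "degen_frobenius_euler n l u =
    smult (of_nat d ^ n * ((- 1 + inverse u) / (1 - u ^ d)))
      (\<Sum>a=0..d-1. smult (u ^ (d - a))
         (pcompose (degen_frobenius_euler n (l / of_nat d) (u ^ d))
                   [:of_nat a / of_nat d, 1 / of_nat d:]))"
proof -
  let ?k = "(- 1 + inverse u) / (1 - u ^ d)"
  let ?E = "degen_power l 1" and ?X = "degen_power l [:0, 1:]"
  let ?G = "degen_frobenius_euler_gf (l / of_nat d) (u ^ d)"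
  let ?s = "\<lambda>a. fps_subst (of_nat d) [:of_nat a / of_nat d, 1 / of_nat d:] ?G"
  let ?U = "fps_const [:u:]"
  define S where "S = (\<Sum>a<d. fps_const [:u ^ (d - a):] * ?s a)"
  define Q where "Q = (\<Sum>a<d. ?U ^ (d - Suc a) * ?E ^ a)"
  have Upow: "?U ^ m = fps_const [:u ^ m:]" for m
    by (induction m) (simp_all add: one_pCons)
  have Q: "?E ^ d - fps_const [:u ^ d:] = (?E - ?U) * Q"
    unfolding Q_def Upow[symmetric] by (rule power_diff_sumr2)
  have D: "?E ^ d - fps_const [:u ^ d:] \<noteq> 0"
  proof
    assume "?E ^ d - fps_const [:u ^ d:] = 0"
    then have "fps_nth (?E ^ d - fps_const [:u ^ d:]) 0 = 0"
      by simp
    then have "[:u ^ d:] = 1"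
      by (simp add: fps_nth_power_0)
    then show False
      using assms(5) by (simp add: one_pCons)
  qed
  have u: "fps_const [:u ^ (d - a):] = ?U * ?U ^ (d - Suc a)" if "a < d" for a
    using that by (simp add: Suc_diff_Suc flip: Upow power_Suc)
  have "(?E ^ d - fps_const [:u ^ d:]) * S =
      (\<Sum>a<d. fps_const [:u ^ (d - a):] * ((?E ^ d - fps_const [:u ^ d:]) * ?s a))"
    by (simp only: S_def sum_distrib_left mult_ac)
  also have "\<dots> = (\<Sum>a<d. ?U * ?U ^ (d - Suc a) * (fps_const [:1 - u ^ d:] * (?E ^ a * ?X)))"
    by (intro sum.cong refl) (simp only: frobenius_euler_gf_subst[OF assms(2,5)] u lessThan_iff)
  also have "\<dots> = fps_const [:1 - u ^ d:] * ?U * ?X * Q"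
    by (simp only: Q_def sum_distrib_left mult_ac)
  finally have S: "(?E ^ d - fps_const [:u ^ d:]) * S = fps_const [:1 - u ^ d:] * ?U * ?X * Q" .
  have k: "fps_const [:?k:] * (fps_const [:1 - u ^ d:] * ?U) = fps_const [:1 - u:]"
    using assms(3,5) by (simp add: field_simps)
  have "(?E ^ d - fps_const [:u ^ d:]) * ((?E - ?U) * (fps_const [:?k:] * S)) =
      fps_const [:?k:] * (?E - ?U) * ((?E ^ d - fps_const [:u ^ d:]) * S)"
    by (simp only: mult_ac)
  also have "\<dots> = (?E - ?U) * Q * ((fps_const [:?k:] * (fps_const [:1 - u ^ d:] * ?U)) * ?X)"
    unfolding S by (simp only: mult_ac)
  also have "\<dots> = (?E ^ d - fps_const [:u ^ d:]) * (fps_const [:1 - u:] * ?X)"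
    by (simp only: k Q)
  finally have "(?E - ?U) * (fps_const [:?k:] * S) = fps_const [:1 - u:] * ?X"
    using D by (metis mult_left_cancel)
  then have gf: "degen_frobenius_euler_gf l u = fps_const [:?k:] * S"
    using degen_frobenius_euler_gf_unique[OF assms(4)] by metis
  have "{0..d-1} = {..<d}"
    using assms(2) by auto
  then show ?thesis
    by (simp add: degen_frobenius_euler_def gf S_def fps_sum_nth pcompose_smult smult_sum_right mult_ac)
qed

end
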